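(* Let $k$ be a positive integer and $A$ a stream with at least $k$ distinct identifiers, and let $h$ be a perfectly random hash function. Let $\theta=\mathrm{AlphaTCF}(k,A,h)$ and let $\mathcal S$ be the number of distinct identifiers of $A$ whose hash value is less than $\theta$. Then $$\mathbb{E}(\mathcal S)=k,\qquad \sigma^2(\mathcal S)<\frac{k}{2}+\frac14.$$
   Context: Identifiers come from $[n]$; a stream is a finite sequence of identifiers. The hash function $h:[n]\to(0,1)$ is perfectly random (i.i.d. Uniform$(0,1)$ values); $h(A)$ is the sequence of hash values in stream order. AlphaTCF$(k,A,h)$: set $\alpha=k/(k+1)$; let the prefix be the shortest prefix of $h(A)$ containing exactly $k$ distinct hash values and the suffix the rest; $D$ := set of distinct hash values in the prefix; $i:=0$; for each $x$ in the suffix, in order: if $x<\alpha^i$ and $x\notin D$, then $i:=i+1$ and $D:=D\cup\{x\}$. Return $\theta=\alpha^i$. *)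

theory Defs
  imports "HOL-Probability.Probability"
begin

text \<open>
  A random hash function on the identifiers \<open>{1..n}\<close> is a family \<open>H\<close> indexed by the sample points:
  \<open>H \<omega>\<close> is the hash function drawn at \<open>\<omega>\<close>.
\<close>

definition perfectly_random_hash ::
    "nat \<Rightarrow> 'w measure \<Rightarrow> ('w \<Rightarrow> nat \<Rightarrow> real) \<Rightarrow> bool" where
  "perfectly_random_hash n M H \<longleftrightarrow>
     prob_space M \<and>
     (\<forall>\<omega>\<in>space M. \<forall>a\<in>{1..n}. H \<omega> a \<in> {0<..<1}) \<and>
     prob_space.indep_vars M (\<lambda>_. borel) (\<lambda>a \<omega>. H \<omega> a) {1..n} \<and>
     (\<forall>a\<in>{1..n}. distr M borel (\<lambda>\<omega>. H \<omega> a) = uniform_measure lborel {0<..<1})"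

text \<open>
  If \<open>xs\<close> has fewer than \<open>k\<close> distinct values, no \<open>j\<close> qualifies below and the value is unspecified.
  For the hash values of a stream with at least \<open>k\<close> distinct identifiers this requires a
  hash collision, an event of probability 0.
\<close>

definition prefix_length :: "nat \<Rightarrow> real list \<Rightarrow> nat" where
  "prefix_length k xs = (LEAST j. card (set (take j xs)) = k)"

definition alpha_TCF_step :: "real \<Rightarrow> real \<Rightarrow> nat \<times> real set \<Rightarrow> nat \<times> real set" where
  "alpha_TCF_step \<alpha> x = (\<lambda>(i, D).
     if x < \<alpha> ^ i \<and> x \<notin> D then (i + 1, insert x D) else (i, D))"

definition alpha_TCF :: "nat \<Rightarrow> nat list \<Rightarrow> (nat \<Rightarrow> real) \<Rightarrow> real" where
  "alpha_TCF k A h =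
     (let \<alpha> = real k / (real k + 1);
          xs = map h A;
          p = prefix_length k xs;
          (i, D) = fold (alpha_TCF_step \<alpha>) (drop p xs) (0, set (take p xs))
      in \<alpha> ^ i)"

definition sample_size :: "nat \<Rightarrow> nat list \<Rightarrow> (nat \<Rightarrow> real) \<Rightarrow> nat" where
  "sample_size k A h = card {a \<in> set A. h a < alpha_TCF k A h}"

end

theory Submission imports Defs begin

text \<open>
  Only first occurrences of identifiers matter, and a new identifier is accepted by comparing its
  hash value with a threshold that depends only on the number of acceptances so far. Fix the final
  number \<open>j\<close> of acceptances and some \<open>t \<le> \<tau> j\<close>. A rejected value is at least \<open>t\<close>, while the value
  accepted after \<open>i\<close> earlier acceptances is uniform on \<open>(0, \<tau> i)\<close> and lies below \<open>t\<close> with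
  probability \<open>t / \<tau> i\<close>, independently of the others. At \<open>t = \<tau> j\<close> these probabilities sum to \<open>k\<close>
  whatever \<open>j\<close> is (this is where \<open>\<alpha> = k / (k + 1)\<close> enters), and their squares sum to at least
  \<open>k\<^sup>2 / (2 k + 1)\<close>. So the conditional mean is constantly \<open>k\<close>, and the variance is the average of
  conditional variances that are at most \<open>(k\<^sup>2 + k) / (2 k + 1) < k / 2 + 1 / 4\<close>.
\<close>

section \<open>The sampling process with thresholds depending on the number of acceptances\<close>

text \<open>The head of the list is the most recent identifier.\<close>

fun accepted :: "(nat \<Rightarrow> real) \<Rightarrow> 'a list \<Rightarrow> ('a \<Rightarrow> real) \<Rightarrow> nat" where
  "accepted \<tau> [] h = 0"
| "accepted \<tau> (a # xs) h =
     (if h a < \<tau> (accepted \<tau> xs h) then Suc (accepted \<tau> xs h) else accepted \<tau> xs h)"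

text \<open>The level \<open>t\<close> is kept separate from the running threshold. For a fixed
  level the count changes by at most one per new identifier, while the threshold may fall during the
  process.\<close>

definition below :: "real \<Rightarrow> 'a list \<Rightarrow> ('a \<Rightarrow> real) \<Rightarrow> nat" where
  "below t xs h = card {a \<in> set xs. h a < t}"

lemma below_Nil [simp]: "below t [] h = 0"
  by (simp add: below_def)

lemma below_Cons:
  assumes "a \<notin> set xs"
  shows "below t (a # xs) h = below t xs h + (if h a < t then 1 else 0)"
proof -
  have "{b \<in> set (a # xs). h b < t} =
      (if h a < t then insert a {b \<in> set xs. h b < t} else {b \<in> set xs. h b < t})"
    by auto
  then show ?thesis
    using assms by (simp add: below_def)
qed

lemma accepted_le_length: "accepted \<tau> xs h \<le> length xs"
  by (induction xs) auto

lemma below_le_length: "below t xs h \<le> length xs"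
proof -
  have "below t xs h \<le> card (set xs)"
    unfolding below_def by (rule card_mono) auto
  then show ?thesis
    using card_length[of xs] by linarith
qed

lemma accepted_cong:
  assumes "\<And>a. a \<in> set xs \<Longrightarrow> h a = h' a"
  shows "accepted \<tau> xs h = accepted \<tau> xs h'"
  using assms by (induction xs) auto

lemma below_cong:
  assumes "\<And>a. a \<in> set xs \<Longrightarrow> h a = h' a"
  shows "below t xs h = below t xs h'"
  unfolding below_def by (rule arg_cong[where f = card]) (use assms in auto)

text \<open>Values less than 1 pass a threshold equal to 1, so no rejection occurs before
  \<open>k\<close> acceptances. This confines the final number to the range where the mean identity
  holds.\<close>

lemma accepted_ge:
  assumes "\<And>a. a \<in> set xs \<Longrightarrow> h a < 1" "\<And>j. j < k \<Longrightarrow> \<tau> j = 1"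
  shows "min k (length xs) \<le> accepted \<tau> xs h"
  using assms(1)
proof (induction xs)
  case (Cons a xs)
  then have "min k (length xs) \<le> accepted \<tau> xs h" "h a < 1"
    by auto
  then show ?case
    using assms(2)[of "accepted \<tau> xs h"] by (cases "accepted \<tau> xs h < k") auto
qed simp

lemma measurable_accepted [measurable (raw)]:
  assumes "\<And>a. a \<in> set xs \<Longrightarrow> (\<lambda>\<omega>. h \<omega> a) \<in> borel_measurable N"
  shows "(\<lambda>\<omega>. accepted \<tau> xs (h \<omega>)) \<in> measurable N (count_space UNIV)"
  using assms
proof (induction xs)
  case (Cons a xs)
  then have [measurable]: "(\<lambda>\<omega>. h \<omega> a) \<in> borel_measurable N"
      "(\<lambda>\<omega>. accepted \<tau> xs (h \<omega>)) \<in> measurable N (count_space UNIV)"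
    by auto
  show ?case
    by simp
qed simp

text \<open>The level may vary with the sample point, because it will be the random threshold
  returned by AlphaTCF.\<close>

lemma measurable_below [measurable (raw)]:
  fixes xs :: "nat list"
  assumes "\<And>a. a \<in> set xs \<Longrightarrow> (\<lambda>\<omega>. h \<omega> a) \<in> borel_measurable N"
    and [measurable]: "t \<in> borel_measurable N"
  shows "(\<lambda>\<omega>. below (t \<omega>) xs (h \<omega>)) \<in> measurable N (count_space UNIV)"
  unfolding below_def
proof (rule measurable_card)
  fix a
  show "{\<omega> \<in> space N. a \<in> {a \<in> set xs. h \<omega> a < t \<omega>}} \<in> sets N"
  proof (cases "a \<in> set xs")
    case True
    then have [measurable]: "(\<lambda>\<omega>. h \<omega> a) \<in> borel_measurable N"
      using assms by auto
    show ?thesis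
      using True by simp
  qed simp
qed

section \<open>Ratios of the AlphaTCF thresholds\<close>

text \<open>
  The truncated subtraction makes the threshold \<open>1\<close> as long as fewer than \<open>k\<close> values have been
  accepted, so that the prefix phase of AlphaTCF is an instance of the same acceptance rule.
\<close>

definition tcf_threshold :: "nat \<Rightarrow> nat \<Rightarrow> real" where
  "tcf_threshold k j = (real k / (real k + 1)) ^ (j - k)"

lemma antimono_tcf_threshold: "antimono (tcf_threshold k)"
  unfolding tcf_threshold_def by (intro antimonoI power_decreasing) auto

lemma tcf_threshold_pos: "0 < k \<Longrightarrow> 0 < tcf_threshold k j"
  by (simp add: tcf_threshold_def)

lemma tcf_threshold_le_1: "tcf_threshold k j \<le> 1"
  unfolding tcf_threshold_def by (intro power_le_one) auto

lemma tcf_threshold_Suc: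
  "k \<le> j \<Longrightarrow> tcf_threshold k (Suc j) = tcf_threshold k j * (real k / (real k + 1))"
  by (simp add: tcf_threshold_def Suc_diff_le)

text \<open>At \<open>j = k\<close> all ratios are 1. One more acceptance appends a ratio 1 and
  scales everything by \<open>k / (k + 1)\<close>, which sends the sum \<open>k\<close> back to
  \<open>k\<close>.\<close>

lemma tcf_threshold_mean:
  assumes "0 < k" "k \<le> j"
  shows "(\<Sum>i<j. tcf_threshold k j / tcf_threshold k i) = real k"
  using assms(2)
proof (induction j rule: dec_induct)
  case base
  show ?case
    by (simp add: tcf_threshold_def)
next
  case (step j)
  let ?\<alpha> = "real k / (real k + 1)"
  have "(\<Sum>i<Suc j. tcf_threshold k (Suc j) / tcf_threshold k i) =
      ?\<alpha> * (\<Sum>i<Suc j. tcf_threshold k j / tcf_threshold k i)"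
    unfolding tcf_threshold_Suc[OF step.hyps(1)] sum_distrib_left
    by (intro sum.cong) simp_all
  also have "\<dots> = ?\<alpha> * (real k + 1)"
    using step.IH tcf_threshold_pos[OF assms(1), of j] by simp
  finally show ?case
    by simp
qed

text \<open>The bound is the fixed point of the increasing map x \<mapsto> \<alpha>^2 (x + 1) that
  governs the sum of squares from \<open>j\<close> to \<open>Suc j\<close>, and the starting value
  \<open>k\<close> lies above it.\<close>

lemma tcf_threshold_squares:
  assumes "0 < k" "k \<le> j"
  shows "real k ^ 2 / (2 * real k + 1) \<le> (\<Sum>i<j. (tcf_threshold k j / tcf_threshold k i)\<^sup>2)"
  using assms(2)
proof (induction j rule: dec_induct)
  case base
  show ?case
    by (simp add: tcf_threshold_def divide_simps power2_eq_square algebra_simps)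
next
  case (step j)
  let ?\<alpha> = "real k / (real k + 1)"
  have "real k ^ 2 / (2 * real k + 1) = ?\<alpha>\<^sup>2 * (real k ^ 2 / (2 * real k + 1) + 1)"
    using assms(1) by (simp add: divide_simps) (simp add: power2_eq_square algebra_simps)
  also have "\<dots> \<le> ?\<alpha>\<^sup>2 * ((\<Sum>i<j. (tcf_threshold k j / tcf_threshold k i)\<^sup>2) + 1)"
    using step.IH by (intro mult_left_mono) auto
  also have "\<dots> = ?\<alpha>\<^sup>2 * (\<Sum>i<Suc j. (tcf_threshold k j / tcf_threshold k i)\<^sup>2)"
    using tcf_threshold_pos[OF assms(1), of j] by simp
  also have "\<dots> = (\<Sum>i<Suc j. (tcf_threshold k (Suc j) / tcf_threshold k i)\<^sup>2)"
    unfolding tcf_threshold_Suc[OF step.hyps(1)] sum_distrib_left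
    by (intro sum.cong) (simp_all add: power_mult_distrib power_divide)
  finally show ?case .
qed

text \<open>The left side is the variance of a sum of independent Bernoulli variables with these
  ratios as success probabilities.\<close>

lemma tcf_threshold_variance:
  assumes "0 < k" "k \<le> j"
  shows "(\<Sum>i<j. tcf_threshold k j / tcf_threshold k i * (1 - tcf_threshold k j / tcf_threshold k i))
    \<le> (real k ^ 2 + real k) / (2 * real k + 1)"
proof -
  have "(\<Sum>i<j. tcf_threshold k j / tcf_threshold k i * (1 - tcf_threshold k j / tcf_threshold k i)) =
      real k - (\<Sum>i<j. (tcf_threshold k j / tcf_threshold k i)\<^sup>2)"
    unfolding tcf_threshold_mean[OF assms, symmetric]
    by (simp add: sum_subtractf[symmetric] power2_eq_square right_diff_distrib)
  also have "\<dots> \<le> real k - real k ^ 2 / (2 * real k + 1)"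
    using tcf_threshold_squares[OF assms] by simp
  also have "\<dots> = (real k ^ 2 + real k) / (2 * real k + 1)"
    by (simp add: divide_simps power2_eq_square algebra_simps)
  finally show ?thesis .
qed

section \<open>Independence and the uniform law\<close>

lemma (in prob_space) expectation_indep_indicator:
  fixes X :: "'i \<Rightarrow> 'a \<Rightarrow> real"
  assumes "indep_vars (\<lambda>_. borel) X I" "a \<in> I" "J \<subseteq> I" "a \<notin> J" "B \<in> sets borel"
    and F: "F \<in> borel_measurable (PiM J (\<lambda>_. borel))"
    and F_restrict: "\<And>\<omega>. F (restrict (\<lambda>i. X i \<omega>) J) = G \<omega>"
    and int: "integrable M G"
  shows "expectation (\<lambda>\<omega>. G \<omega> * indicator B (X a \<omega>)) =
         expectation G * prob {\<omega> \<in> space M. X a \<omega> \<in> B}"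
proof -
  \<comment> \<open>\<open>G\<close> factors through the values indexed by \<open>J\<close>, and
    \<open>a\<close> lies outside \<open>J\<close>.\<close>
  have "indep_var borel (F \<circ> (\<lambda>\<omega>. restrict (\<lambda>i. X i \<omega>) J))
          borel ((\<lambda>f. indicator B (f a) :: real) \<circ> (\<lambda>\<omega>. restrict (\<lambda>i. X i \<omega>) {a}))"
    using assms by (intro indep_var_compose[OF indep_var_restrict]) auto
  then have indep: "indep_var borel G borel (\<lambda>\<omega>. indicator B (X a \<omega>) :: real)"
    by (simp add: o_def F_restrict)
  have [measurable]: "X a \<in> borel_measurable M" "B \<in> sets borel"
    using assms by (auto simp: indep_vars_def)
  have "expectation (\<lambda>\<omega>. indicator B (X a \<omega>) :: real) =
        expectation (indicator {\<omega> \<in> space M. X a \<omega> \<in> B})"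
    by (intro Bochner_Integration.integral_cong) (auto simp: indicator_def)
  moreover have "integrable M (\<lambda>\<omega>. indicator B (X a \<omega>) :: real)"
    by (intro integrable_const_bound[where B = 1]) auto
  ultimately show ?thesis
    using indep_var_lebesgue_integral[OF indep int] by simp
qed

lemma (in prob_space) prob_uniform_less:
  fixes X :: "'a \<Rightarrow> real"
  assumes [measurable]: "X \<in> borel_measurable M"
    and "distr M borel X = uniform_measure lborel {0<..<1}" and "0 \<le> s" "s \<le> t" "t \<le> 1"
  shows "prob {\<omega> \<in> space M. X \<omega> \<in> {s..<t}} = t - s"
proof -
  have "prob {\<omega> \<in> space M. X \<omega> \<in> {s..<t}} = measure (distr M borel X) {s..<t}"
    by (subst measure_distr) (auto intro!: arg_cong[where f = prob])
  also have "\<dots> = measure lborel ({0<..<1} \<inter> {s..<t})"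
    unfolding assms by (simp add: measure_def emeasure_uniform_measure divide_ennreal_def)
  \<comment> \<open>The open interval loses the endpoint 0, the only place where the intersection is
    not the given half-open interval.\<close>
  also have "{0<..<1} \<inter> {s..<t} = (if s = 0 then {0<..<t} else {s..<t})"
    using assms by auto
  also have "measure lborel \<dots> = t - s"
    using assms by auto
  finally show ?thesis .
qed

section \<open>Moments restricted to a final number of acceptances\<close>

locale uniform_family = prob_space +
  fixes X :: "nat \<Rightarrow> 'a \<Rightarrow> real" and I :: "nat set"
  assumes indep: "indep_vars (\<lambda>_. borel) X I"
    and uniform: "a \<in> I \<Longrightarrow> distr M borel (X a) = uniform_measure lborel {0<..<1}"
    and range: "a \<in> I \<Longrightarrow> \<omega> \<in> space M \<Longrightarrow> X a \<omega> \<in> {0<..<1}"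
begin

lemma measurable_X [measurable (raw)]: "a \<in> I \<Longrightarrow> X a \<in> borel_measurable M"
  using indep by (auto simp: indep_vars_def)

text \<open>The event is a factor of the integrand instead of a condition, which avoids dividing by
  a probability that may be 0. With \<open>g\<close> constantly 1 the expectation is the probability
  of the event.\<close>

definition below_on_accepted :: "(nat \<Rightarrow> real) \<Rightarrow> nat list \<Rightarrow> nat \<Rightarrow> real \<Rightarrow> (nat \<Rightarrow> real) \<Rightarrow> 'a \<Rightarrow> real" where
  "below_on_accepted \<tau> xs j t g \<omega> =
     of_bool (accepted \<tau> xs (\<lambda>a. X a \<omega>) = j) * g (below t xs (\<lambda>a. X a \<omega>))"

lemma measurable_below_on_accepted [measurable (raw)]:
  assumes "set xs \<subseteq> I"
  shows "below_on_accepted \<tau> xs j t g \<in> borel_measurable M"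
proof -
  have [measurable]: "(\<lambda>\<omega>. accepted \<tau> xs (\<lambda>a. X a \<omega>)) \<in> measurable M (count_space UNIV)"
    "(\<lambda>\<omega>. below t xs (\<lambda>a. X a \<omega>)) \<in> measurable M (count_space UNIV)"
    using assms by (auto intro!: measurable_accepted measurable_below measurable_X)
  show ?thesis
    unfolding below_on_accepted_def[abs_def] by measurable
qed

lemma integrable_below_on_accepted [intro]:
  assumes "set xs \<subseteq> I"
  shows "integrable M (below_on_accepted \<tau> xs j t g)"
proof (rule integrable_const_bound)
  \<comment> \<open>The count has finitely many possible values, so summing over all of them gives a
    crude uniform bound.\<close>
  have "\<bar>g (below t xs h)\<bar> \<le> (\<Sum>s\<le>length xs. \<bar>g s\<bar>)" for h
    by (rule member_le_sum) (auto simp: below_le_length)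
  then show "AE \<omega> in M. norm (below_on_accepted \<tau> xs j t g \<omega>) \<le> (\<Sum>s\<le>length xs. \<bar>g s\<bar>)"
    by (auto simp: below_on_accepted_def intro!: sum_nonneg)
qed (use assms in measurable)

text \<open>The process on \<open>xs\<close> reads only the hash values of \<open>xs\<close>, so the
  value of a new identifier is independent of it and uniform.\<close>

lemma expectation_below_on_accepted_indicator:
  assumes "set xs \<subseteq> I" "a \<in> I" "a \<notin> set xs" "0 \<le> u" "u \<le> v" "v \<le> 1"
  shows "expectation (\<lambda>\<omega>. below_on_accepted \<tau> xs j t g \<omega> * indicator {u..<v} (X a \<omega>)) =
         expectation (below_on_accepted \<tau> xs j t g) * (v - u)"
proof -
  let ?F = "\<lambda>h. of_bool (accepted \<tau> xs h = j) * g (below t xs h)"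
  have [measurable]: "(\<lambda>h. accepted \<tau> xs h) \<in> measurable (PiM (set xs) (\<lambda>_. borel)) (count_space UNIV)"
    "(\<lambda>h. below t xs h) \<in> measurable (PiM (set xs) (\<lambda>_. borel)) (count_space UNIV)"
    by (auto intro!: measurable_accepted measurable_below)
  have "?F \<in> borel_measurable (PiM (set xs) (\<lambda>_. borel))"
    by measurable
  moreover have "?F (restrict (\<lambda>i. X i \<omega>) (set xs)) = below_on_accepted \<tau> xs j t g \<omega>" for \<omega>
    using accepted_cong[of xs "restrict (\<lambda>i. X i \<omega>) (set xs)" "\<lambda>a. X a \<omega>" \<tau>]
      below_cong[of xs "restrict (\<lambda>i. X i \<omega>) (set xs)" "\<lambda>a. X a \<omega>" t]
    by (simp add: below_on_accepted_def)
  ultimately show ?thesis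
    using expectation_indep_indicator[OF indep assms(2,1,3), of "{u..<v}" ?F "below_on_accepted \<tau> xs j t g"]
      prob_uniform_less[of "X a" u v] assms integrable_below_on_accepted uniform measurable_X
    by simp
qed

text \<open>
  Quantifying over \<open>c\<close> makes the induction close: a new value below \<open>t\<close> replaces \<open>c\<close> by \<open>c - 1\<close>.
\<close>

lemma expectation_below_on_accepted_square:
  fixes \<tau> :: "nat \<Rightarrow> real"
  assumes \<tau>: "antimono \<tau>" "\<And>i. 0 < \<tau> i" "\<And>i. \<tau> i \<le> 1"
    and "set xs \<subseteq> I" "distinct xs" "0 \<le> t" "t \<le> \<tau> j"
  shows "expectation (below_on_accepted \<tau> xs j t (\<lambda>s. (real s - c)\<^sup>2)) =
         expectation (below_on_accepted \<tau> xs j t (\<lambda>_. 1)) *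
         (((\<Sum>i<j. t / \<tau> i) - c)\<^sup>2 + (\<Sum>i<j. t / \<tau> i * (1 - t / \<tau> i)))"
  using assms(4-)
proof (induction xs arbitrary: j c)
  case Nil
  then show ?case
    by (cases "j = 0") (simp_all add: below_on_accepted_def[abs_def] prob_space)
next
  case (Cons a xs)
  then have xs: "set xs \<subseteq> I" "distinct xs" "a \<in> I" "a \<notin> set xs"
    by auto
  note IH = Cons.IH[OF xs(1,2) Cons.prems(3)]
  have ind: "expectation (\<lambda>\<omega>. below_on_accepted \<tau> xs i t g \<omega> * indicator {u..<v} (X a \<omega>)) =
      expectation (below_on_accepted \<tau> xs i t g) * (v - u)" if "0 \<le> u" "u \<le> v" "v \<le> 1" for i g u v
    by (rule expectation_below_on_accepted_indicator[OF xs(1,3,4) that])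
  have int: "integrable M (\<lambda>\<omega>. below_on_accepted \<tau> xs i t g \<omega> * indicator {u..<v} (X a \<omega>))" for i g u v
  proof (rule Bochner_Integration.integrable_bound[OF integrable_below_on_accepted[OF xs(1), of \<tau> i t g]])
    have [measurable]: "X a \<in> borel_measurable M" "below_on_accepted \<tau> xs i t g \<in> borel_measurable M"
      using xs by auto
    show "(\<lambda>\<omega>. below_on_accepted \<tau> xs i t g \<omega> * indicator {u..<v} (X a \<omega>)) \<in> borel_measurable M"
      by measurable
  qed (simp add: indicator_def)
  have Xa: "X a \<omega> < 1" "0 \<le> X a \<omega>" if "\<omega> \<in> space M" for \<omega>
    using range[OF xs(3) that] by auto
  show ?case
  proof (cases j)
    case 0
    \<comment> \<open>Zero acceptances force the new value to be rejected. It is then at least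
      \<open>\<tau> 0\<close>, hence at least \<open>t\<close>, and the count does not
      change.\<close>
    have *: "expectation (below_on_accepted \<tau> (a # xs) 0 t g) =
        expectation (below_on_accepted \<tau> xs 0 t g) * (1 - \<tau> 0)" for g
    proof -
      have "expectation (below_on_accepted \<tau> (a # xs) 0 t g) =
          expectation (\<lambda>\<omega>. below_on_accepted \<tau> xs 0 t g \<omega> * indicator {\<tau> 0..<1} (X a \<omega>))"
      proof (rule Bochner_Integration.integral_cong[OF refl])
        fix \<omega> assume "\<omega> \<in> space M"
        then show "below_on_accepted \<tau> (a # xs) 0 t g \<omega> = below_on_accepted \<tau> xs 0 t g \<omega> * indicator {\<tau> 0..<1} (X a \<omega>)"
          using Xa[of \<omega>] Cons.prems 0 xs
          by (cases "accepted \<tau> xs (\<lambda>a. X a \<omega>) = 0") (auto simp: below_on_accepted_def below_Cons indicator_def)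
      qed
      then show ?thesis
        using ind[of "\<tau> 0" 1 0 g] \<tau>(2)[of 0] \<tau>(3)[of 0] by simp
    qed
    show ?thesis
      using IH[of 0 c] Cons.prems 0 by (simp add: *)
  next
    case (Suc i)
    define q where "q = t / \<tau> i"
    \<comment> \<open>The level stays fixed while the index drops to \<open>i\<close>, so the
      induction has to allow levels strictly under the threshold.\<close>
    have ti: "\<tau> (Suc i) \<le> \<tau> i" "t \<le> \<tau> i" "0 < \<tau> i"
      using \<tau> Cons.prems Suc antimonoD[OF \<tau>(1), of i "Suc i"] by auto
    \<comment> \<open>Three disjoint cases: the new value is rejected after \<open>Suc i\<close>
      acceptances, or accepted after \<open>i\<close> of them either below \<open>t\<close>, which
      raises the count, or in \<open>{t..<\<tau> i}\<close>.\<close>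
    have *: "expectation (below_on_accepted \<tau> (a # xs) (Suc i) t g) =
        expectation (below_on_accepted \<tau> xs (Suc i) t g) * (1 - \<tau> (Suc i)) +
        expectation (below_on_accepted \<tau> xs i t (\<lambda>s. g (Suc s))) * t +
        expectation (below_on_accepted \<tau> xs i t g) * (\<tau> i - t)" for g
    proof -
      have "expectation (below_on_accepted \<tau> (a # xs) (Suc i) t g) =
          expectation (\<lambda>\<omega>. below_on_accepted \<tau> xs (Suc i) t g \<omega> * indicator {\<tau> (Suc i)..<1} (X a \<omega>) +
            below_on_accepted \<tau> xs i t (\<lambda>s. g (Suc s)) \<omega> * indicator {0..<t} (X a \<omega>) +
            below_on_accepted \<tau> xs i t g \<omega> * indicator {t..<\<tau> i} (X a \<omega>))"
        using Xa Cons.prems Suc xs ti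
        by (intro Bochner_Integration.integral_cong)
           (auto simp: below_on_accepted_def below_Cons indicator_def)
      then show ?thesis
        using ind[of "\<tau> (Suc i)" 1 "Suc i" g] ind[of 0 t i "\<lambda>s. g (Suc s)"] ind[of t "\<tau> i" i g]
          int ti Cons.prems Suc \<tau>(2,3)[of "Suc i"] \<tau>(3)[of i]
        by simp
    qed
    define P m v where "P = expectation (below_on_accepted \<tau> xs i t (\<lambda>_. 1))"
      and "m = (\<Sum>i<i. t / \<tau> i)" and "v = (\<Sum>i<i. t / \<tau> i * (1 - t / \<tau> i))"
    have t: "t = q * \<tau> i"
      using ti by (simp add: q_def)
    have Suc_shift: "(real (Suc s) - c)\<^sup>2 = (real s - (c - 1))\<^sup>2" for s
      by (simp add: algebra_simps)
    \<comment> \<open>An accepted value lies below \<open>t\<close> with probability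
      \<open>q\<close>. Adding this Bernoulli variable moves the mean by \<open>q\<close> and the
      variance by \<open>q * (1 - q)\<close>.\<close>
    have "P * ((m - (c - 1))\<^sup>2 + v) * t + P * ((m - c)\<^sup>2 + v) * (\<tau> i - t) =
        P * \<tau> i * ((m + q - c)\<^sup>2 + (v + q * (1 - q)))"
      unfolding t by (simp add: power2_eq_square algebra_simps)
    moreover have "(\<Sum>i<Suc i. t / \<tau> i) = m + q"
        "(\<Sum>i<Suc i. t / \<tau> i * (1 - t / \<tau> i)) = v + q * (1 - q)"
      by (simp_all add: m_def v_def q_def)
    moreover have "expectation (below_on_accepted \<tau> xs (Suc i) t (\<lambda>s. (real s - c)\<^sup>2)) =
        expectation (below_on_accepted \<tau> xs (Suc i) t (\<lambda>_. 1)) * ((m + q - c)\<^sup>2 + (v + q * (1 - q)))"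
      using IH[of "Suc i" c] Cons.prems(4) calculation(2,3) Suc by simp
    moreover have "expectation (below_on_accepted \<tau> xs i t (\<lambda>s. (real s - c)\<^sup>2)) = P * ((m - c)\<^sup>2 + v)" for c
      using IH[of i c] ti(2) by (simp add: P_def m_def v_def)
    ultimately show ?thesis
      unfolding Suc * Suc_shift P_def[symmetric] by (simp only: distrib_right[symmetric]) (simp add: algebra_simps)
  qed
qed

section \<open>Almost sure absence of hash collisions\<close>

lemma AE_inj_on:
  assumes "finite J" "J \<subseteq> I"
  shows "AE \<omega> in M. inj_on (\<lambda>a. X a \<omega>) J"
proof -
  have "AE \<omega> in M. X a \<omega> \<noteq> X b \<omega>" if ab: "a \<in> J" "b \<in> J" "a \<noteq> b" for a b
  proof -
    have [measurable]: "X a \<in> borel_measurable M" "X b \<in> borel_measurable M"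
      using ab assms by (auto intro!: measurable_X)
    have "indep_var borel ((\<lambda>f. f a) \<circ> (\<lambda>\<omega>. restrict (\<lambda>i. X i \<omega>) {a}))
            borel ((\<lambda>f. f b) \<circ> (\<lambda>\<omega>. restrict (\<lambda>i. X i \<omega>) {b}))"
      using ab assms by (intro indep_var_compose[OF indep_var_restrict[OF indep]]) auto
    then have "indep_var borel (X a) borel (X b)"
      by (simp add: o_def)
    then have pair: "distr M borel (X a) \<Otimes>\<^sub>M distr M borel (X b) =
        distr M (borel \<Otimes>\<^sub>M borel) (\<lambda>\<omega>. (X a \<omega>, X b \<omega>))"
      by (simp add: indep_var_distribution_eq)
    interpret A: prob_space "distr M borel (X a)"
      by (rule prob_space_distr) simp
    interpret B: prob_space "distr M borel (X b)"
      by (rule prob_space_distr) simp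
    interpret AB: pair_prob_space "distr M borel (X a)" "distr M borel (X b)" ..
    \<comment> \<open>The joint law is a product, so one value may be fixed; the uniform law of the
      other has no atoms.\<close>
    have "AE y in distr M borel (X b). x \<noteq> y" for x
    proof -
      have "distr M borel (X b) = uniform_measure lborel {0<..<1}"
        using ab assms by (intro uniform) auto
      moreover have "AE y in uniform_measure lborel {0<..<1::real}. x \<noteq> y"
        using AE_lborel_singleton[of x] by (intro AE_uniform_measureI) auto
      ultimately show ?thesis
        by (simp only:)
    qed
    then have "AE p in distr M borel (X a) \<Otimes>\<^sub>M distr M borel (X b). fst p \<noteq> snd p"
    proof (intro AB.AE_pair_measure)
      have "{p \<in> space (borel \<Otimes>\<^sub>M borel). fst p \<noteq> snd p} \<in> sets (borel \<Otimes>\<^sub>M borel :: (real \<times> real) measure)"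
        by measurable
      then show "{p \<in> space (distr M borel (X a) \<Otimes>\<^sub>M distr M borel (X b)). fst p \<noteq> snd p}
          \<in> sets (distr M borel (X a) \<Otimes>\<^sub>M distr M borel (X b))"
        by (simp add: space_pair_measure)
    qed simp
    then show ?thesis
      unfolding pair by (subst (asm) AE_distr_iff) auto
  qed
  then have "AE \<omega> in M. \<forall>a\<in>J. \<forall>b\<in>J. a \<noteq> b \<longrightarrow> X a \<omega> \<noteq> X b \<omega>"
    using assms by (intro AE_finite_allI) auto
  then show ?thesis
    by eventually_elim (auto simp: inj_on_def)
qed

section \<open>Second moments at the random final threshold\<close>

lemma expectation_below_tcf_threshold:
  fixes k :: nat
  defines "\<tau> \<equiv> tcf_threshold k"
  assumes "0 < k" "k \<le> length xs" "set xs \<subseteq> I" "distinct xs"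
  obtains V where "V \<le> (real k ^ 2 + real k) / (2 * real k + 1)"
    and "\<And>c. expectation (\<lambda>\<omega>. (real (below (\<tau> (accepted \<tau> xs (\<lambda>a. X a \<omega>))) xs (\<lambda>a. X a \<omega>)) - c)\<^sup>2) =
           (real k - c)\<^sup>2 + V"
proof
  let ?L = "length xs"
  \<comment> \<open>\<open>P j\<close> is the probability of \<open>j\<close> acceptances,
    \<open>v j\<close> the conditional variance and \<open>W\<close> its bound for all
    \<open>j\<close> from \<open>k\<close> on.\<close>
  define P v W where "P j = expectation (below_on_accepted \<tau> xs j (\<tau> j) (\<lambda>_. 1))"
    and "v j = (\<Sum>i<j. \<tau> j / \<tau> i * (1 - \<tau> j / \<tau> i))"
    and "W = (real k ^ 2 + real k) / (2 * real k + 1)" for j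
  \<comment> \<open>The conditional mean is always \<open>k\<close>, so no variance between the
    cases arises and \<open>V\<close> does not depend on \<open>c\<close>.\<close>
  define V where "V = (\<Sum>j\<le>?L. P j * v j)"
  have \<tau>: "antimono \<tau>" "0 < \<tau> i" "\<tau> i \<le> 1" for i
    unfolding \<tau>_def by (simp_all add: antimono_tcf_threshold tcf_threshold_pos tcf_threshold_le_1 \<open>0 < k\<close>)
  \<comment> \<open>Splitting by the final number of acceptances turns the random level into the
    constant \<open>\<tau> j\<close> in each summand.\<close>
  have decompose: "expectation (\<lambda>\<omega>. g (below (\<tau> (accepted \<tau> xs (\<lambda>a. X a \<omega>))) xs (\<lambda>a. X a \<omega>))) =
      (\<Sum>j\<le>?L. expectation (below_on_accepted \<tau> xs j (\<tau> j) g))" for g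
  proof -
    have "g (below (\<tau> (accepted \<tau> xs (\<lambda>a. X a \<omega>))) xs (\<lambda>a. X a \<omega>)) =
        (\<Sum>j\<le>?L. below_on_accepted \<tau> xs j (\<tau> j) g \<omega>)" for \<omega>
    proof -
      have "below_on_accepted \<tau> xs j (\<tau> j) g \<omega> = (if accepted \<tau> xs (\<lambda>a. X a \<omega>) = j
          then g (below (\<tau> (accepted \<tau> xs (\<lambda>a. X a \<omega>))) xs (\<lambda>a. X a \<omega>)) else 0)" for j
        by (simp add: below_on_accepted_def)
      then show ?thesis
        using accepted_le_length[of \<tau> xs "\<lambda>a. X a \<omega>"] by simp
    qed
    then show ?thesis
      using integrable_below_on_accepted[OF \<open>set xs \<subseteq> I\<close>] by simp
  qed
  have P_nonneg: "0 \<le> P j" for j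
    unfolding P_def by (rule Bochner_Integration.integral_nonneg) (simp add: below_on_accepted_def)
  have P_small: "P j = 0" if "j < k" for j
  proof -
    have "below_on_accepted \<tau> xs j (\<tau> j) (\<lambda>_. 1) \<omega> = 0" if "\<omega> \<in> space M" for \<omega>
    proof -
      have "min k ?L \<le> accepted \<tau> xs (\<lambda>a. X a \<omega>)"
        using range[OF _ that] \<open>set xs \<subseteq> I\<close>
        by (intro accepted_ge) (auto simp: \<tau>_def tcf_threshold_def)
      then show ?thesis
        using \<open>j < k\<close> \<open>k \<le> ?L\<close> by (simp add: below_on_accepted_def)
    qed
    then show ?thesis
      unfolding P_def by (subst Bochner_Integration.integral_cong[OF refl, where g = "\<lambda>_. 0"]) auto
  qed
  have P_sum: "(\<Sum>j\<le>?L. P j) = 1"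
    using decompose[of "\<lambda>_. 1"] by (simp add: P_def prob_space)
  have "V \<le> (\<Sum>j\<le>?L. P j * W)"
    unfolding V_def
  proof (rule sum_mono)
    fix j
    show "P j * v j \<le> P j * W"
    proof (cases "j < k")
      case False
      then have "v j \<le> W"
        unfolding v_def W_def \<tau>_def using tcf_threshold_variance[of k j] \<open>0 < k\<close> by simp
      then show ?thesis
        by (rule mult_left_mono[OF _ P_nonneg])
    qed (simp add: P_small)
  qed
  also have "\<dots> = W"
    using P_sum by (simp add: sum_distrib_right[symmetric])
  finally show "V \<le> (real k ^ 2 + real k) / (2 * real k + 1)"
    by (simp add: W_def)
  fix c
  have "expectation (\<lambda>\<omega>. (real (below (\<tau> (accepted \<tau> xs (\<lambda>a. X a \<omega>))) xs (\<lambda>a. X a \<omega>)) - c)\<^sup>2) =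
      (\<Sum>j\<le>?L. P j * (((\<Sum>i<j. \<tau> j / \<tau> i) - c)\<^sup>2 + v j))"
    using decompose[of "\<lambda>s. (real s - c)\<^sup>2"] \<tau> assms
    by (simp add: expectation_below_on_accepted_square less_imp_le P_def v_def)
  also have "\<dots> = (\<Sum>j\<le>?L. P j * ((real k - c)\<^sup>2 + v j))"
  proof (rule sum.cong[OF refl])
    fix j
    show "P j * (((\<Sum>i<j. \<tau> j / \<tau> i) - c)\<^sup>2 + v j) = P j * ((real k - c)\<^sup>2 + v j)"
      using tcf_threshold_mean[of k j] \<open>0 < k\<close> P_small[of j]
      by (cases "j < k") (simp_all add: \<tau>_def)
  qed
  also have "\<dots> = (real k - c)\<^sup>2 + V"
    using P_sum by (simp add: V_def distrib_left sum.distrib sum_distrib_right[symmetric])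
  finally show "expectation (\<lambda>\<omega>. (real (below (\<tau> (accepted \<tau> xs (\<lambda>a. X a \<omega>))) xs (\<lambda>a. X a \<omega>)) - c)\<^sup>2) =
      (real k - c)\<^sup>2 + V" .
qed

end

section \<open>Reduction of AlphaTCF to the sampling process\<close>

text \<open>The cardinality of the sample replaces the counter, so one rule covers prefix and
  suffix.\<close>

definition threshold_insert :: "(nat \<Rightarrow> real) \<Rightarrow> real \<Rightarrow> real set \<Rightarrow> real set" where
  "threshold_insert \<tau> x D = (if x < \<tau> (card D) \<and> x \<notin> D then insert x D else D)"

text \<open>Each acceptance raises the counter and the cardinality together, so their difference
  stays \<open>k\<close>.\<close>

lemma fold_alpha_TCF_step:
  fixes k :: nat and xs :: "real list" and D :: "real set"
  defines "D' \<equiv> fold (threshold_insert (tcf_threshold k)) xs D"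
  assumes "finite D" "card D = k + i"
  shows "fold (alpha_TCF_step (real k / (real k + 1))) xs (i, D) = (card D' - k, D')"
  using assms(2,3) unfolding D'_def
proof (induction xs arbitrary: i D)
  case (Cons x xs)
  let ?\<alpha> = "real k / (real k + 1)"
  show ?case
  proof (cases "x < ?\<alpha> ^ i \<and> x \<notin> D")
    case True
    with Cons.prems Cons.IH[of "insert x D" "Suc i"] show ?thesis
      by (simp add: alpha_TCF_step_def threshold_insert_def tcf_threshold_def)
  next
    case False
    with Cons.prems Cons.IH[of D i] show ?thesis
      by (auto simp: alpha_TCF_step_def threshold_insert_def tcf_threshold_def)
  qed
qed simp

text \<open>Before each genuine insertion the sample has fewer than \<open>k\<close> elements, so
  the threshold is still 1 and every new value enters.\<close>

lemma fold_threshold_insert_prefix: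
  assumes "finite D" "card (D \<union> set xs) \<le> k" "\<And>x. x \<in> set xs \<Longrightarrow> x < 1"
  shows "fold (threshold_insert (tcf_threshold k)) xs D = D \<union> set xs"
  using assms
proof (induction xs arbitrary: D)
  case (Cons x xs)
  have "card (insert x D) \<le> card (D \<union> set (x # xs))"
    using Cons.prems by (intro card_mono) auto
  then have "threshold_insert (tcf_threshold k) x D = insert x D"
    using Cons.prems
    by (cases "x \<in> D") (auto simp: threshold_insert_def tcf_threshold_def insert_absorb)
  then show ?case
    using Cons.IH[of "insert x D"] Cons.prems by simp
qed simp

text \<open>Rejected identifiers stay above the threshold, so their later occurrences are rejected too.\<close>

lemma fold_threshold_insert_map:
  fixes \<tau> :: "nat \<Rightarrow> real"
  assumes "antimono \<tau>" "inj_on h (set A)"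
  defines "D \<equiv> fold (threshold_insert \<tau>) (map h A) {}"
  shows "D \<subseteq> h ` set A" "card D = accepted \<tau> (remdups (rev A)) h"
    "\<And>a. a \<in> set A \<Longrightarrow> h a \<notin> D \<Longrightarrow> \<tau> (card D) \<le> h a"
proof -
  have "D \<subseteq> h ` set A \<and> card D = accepted \<tau> (remdups (rev A)) h \<and>
      (\<forall>a\<in>set A. h a \<notin> D \<longrightarrow> \<tau> (card D) \<le> h a)"
    using assms(2) unfolding D_def
  \<comment> \<open>\<open>remdups\<close> keeps last occurrences, which in \<open>rev A\<close> are
    the first arrivals. An appended identifier thus becomes a new head or changes nothing.\<close>
  proof (induction A rule: rev_induct)
    case (snoc a A)
    define E where "E = fold (threshold_insert \<tau>) (map h A) {}"
    have E: "E \<subseteq> h ` set A" "card E = accepted \<tau> (remdups (rev A)) h"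
        "\<forall>a\<in>set A. h a \<notin> E \<longrightarrow> \<tau> (card E) \<le> h a"
      using snoc by (auto simp: E_def inj_on_def)
    have "finite E"
      using E(1) by (rule finite_subset) simp
    \<comment> \<open>An acceptance cannot raise the threshold, so values rejected earlier remain at
      or above it.\<close>
    have mono: "\<tau> (Suc (card E)) \<le> \<tau> (card E)"
      using antimonoD[OF assms(1)] by simp
    have fold: "fold (threshold_insert \<tau>) (map h (A @ [a])) {} = threshold_insert \<tau> (h a) E"
      by (simp add: E_def)
    show ?case
    proof (cases "a \<in> set A")
      case True
      then have "threshold_insert \<tau> (h a) E = E"
        using E(3) by (auto simp: threshold_insert_def)
      then show ?thesis
        using E True unfolding fold by auto
    next
      case False
      then have "h a \<notin> E"
        using E(1) snoc.prems by (auto simp: inj_on_def)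
      then show ?thesis
        using E False \<open>finite E\<close> mono unfolding fold
        by (auto simp: threshold_insert_def intro: order_trans)
    qed
  qed simp
  then show "D \<subseteq> h ` set A" "card D = accepted \<tau> (remdups (rev A)) h"
    "\<And>a. a \<in> set A \<Longrightarrow> h a \<notin> D \<Longrightarrow> \<tau> (card D) \<le> h a"
    by auto
qed

text \<open>A discrete intermediate value argument: the number of distinct values starts at 0, grows
  by at most 1 per entry and ends at \<open>k\<close> or more. Hence the \<open>LEAST\<close> is
  attained.\<close>

lemma card_take_prefix_length:
  assumes "k \<le> card (set xs)"
  shows "card (set (take (prefix_length k xs) xs)) = k"
proof -
  have step: "card (set (take (i + 1) xs)) \<le> card (set (take i xs)) + 1"
      "card (set (take i xs)) \<le> card (set (take (i + 1) xs))" if "i < length xs" for i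
    using that by (auto simp: take_Suc_conv_app_nth card_insert_if)
  have "\<exists>i\<le>length xs. int (card (set (take i xs))) = int k"
  proof (rule nat0_intermed_int_val)
    show "\<forall>i<length xs. \<bar>int (card (set (take (i + 1) xs))) - int (card (set (take i xs)))\<bar> \<le> 1"
    proof safe
      fix i assume "i < length xs"
      then show "\<bar>int (card (set (take (i + 1) xs))) - int (card (set (take i xs)))\<bar> \<le> 1"
        using step[of i] by linarith
    qed
  qed (use assms in auto)
  then show ?thesis
    unfolding prefix_length_def by (metis (mono_tags, lifting) LeastI_ex of_nat_eq_iff)
qed

text \<open>The prefix phase is the same fold started from the empty sample, so both phases merge
  into one fold over the stream. Injectivity ensures \<open>k\<close> distinct hash values.\<close>

lemma alpha_TCF_eq_tcf_threshold:
  assumes "0 < k" "inj_on h (set A)" "k \<le> card (set A)" "\<And>a. a \<in> set A \<Longrightarrow> h a < 1"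
  shows "alpha_TCF k A h = tcf_threshold k (accepted (tcf_threshold k) (remdups (rev A)) h)"
proof -
  let ?ins = "threshold_insert (tcf_threshold k)"
  define xs p where "xs = map h A" and "p = prefix_length k xs"
  have p: "card (set (take p xs)) = k"
    unfolding p_def xs_def using assms by (intro card_take_prefix_length) (simp add: card_image)
  have "fold ?ins (take p xs) {} = set (take p xs)"
  proof (subst fold_threshold_insert_prefix)
    fix x assume "x \<in> set (take p xs)"
    then have "x \<in> set xs"
      by (rule in_set_takeD)
    then show "x < 1"
      using assms by (auto simp: xs_def)
  qed (use p in auto)
  then have "fold ?ins (drop p xs) (set (take p xs)) = fold ?ins xs {}"
    by (metis append_take_drop_id comp_apply fold_append)
  then have "fold (alpha_TCF_step (real k / (real k + 1))) (drop p xs) (0, set (take p xs)) =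
      (card (fold ?ins xs {}) - k, fold ?ins xs {})"
    using fold_alpha_TCF_step[of "set (take p xs)" k 0 "drop p xs"] p by simp
  then have "alpha_TCF k A h = tcf_threshold k (card (fold ?ins xs {}))"
    by (simp add: alpha_TCF_def xs_def p_def tcf_threshold_def)
  also have "card (fold ?ins xs {}) = accepted (tcf_threshold k) (remdups (rev A)) h"
    unfolding xs_def using assms by (intro fold_threshold_insert_map antimono_tcf_threshold)
  finally show ?thesis .
qed

section \<open>Measurability of AlphaTCF\<close>

lemma measurable_fold_alpha_TCF_step:
  fixes bs :: "'a list"
  assumes "\<And>a. a \<in> set bs \<union> set zs \<Longrightarrow> (\<lambda>\<omega>. h \<omega> a) \<in> borel_measurable N"
  shows "(\<lambda>\<omega>. fst (fold (alpha_TCF_step \<alpha>) (map (h \<omega>) bs) (i, h \<omega> ` set zs)))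
           \<in> measurable N (count_space UNIV)"
  using assms
\<comment> \<open>Writing the random sample as the image of a fixed list \<open>zs\<close> reduces
  membership to finitely many comparisons of hash values. Insertion extends
  \<open>zs\<close>.\<close>
proof (induction bs arbitrary: i zs)
  case (Cons b bs)
  let ?R = "\<lambda>\<omega> i zs. fst (fold (alpha_TCF_step \<alpha>) (map (h \<omega>) bs) (i, h \<omega> ` set zs))"
  have [measurable]: "(\<lambda>\<omega>. h \<omega> b) \<in> borel_measurable N"
      "\<And>a. a \<in> set zs \<Longrightarrow> (\<lambda>\<omega>. h \<omega> a) \<in> borel_measurable N"
      "(\<lambda>\<omega>. ?R \<omega> i zs) \<in> measurable N (count_space UNIV)"
      "(\<lambda>\<omega>. ?R \<omega> (i + 1) (b # zs)) \<in> measurable N (count_space UNIV)"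
    using Cons.prems Cons.IH[of zs i] Cons.IH[of "b # zs" "i + 1"] by auto
  have "fst (fold (alpha_TCF_step \<alpha>) (map (h \<omega>) (b # bs)) (i, h \<omega> ` set zs)) =
      (if h \<omega> b < \<alpha> ^ i \<and> (\<forall>a\<in>set zs. h \<omega> b \<noteq> h \<omega> a) then ?R \<omega> (i + 1) (b # zs) else ?R \<omega> i zs)" for \<omega>
    by (auto simp: alpha_TCF_step_def)
  then show ?case
    by simp
qed simp

lemma measurable_card_image:
  assumes "\<And>a. a \<in> set zs \<Longrightarrow> (\<lambda>\<omega>. h \<omega> a) \<in> borel_measurable N"
  shows "(\<lambda>\<omega>. card ((h \<omega> :: 'a \<Rightarrow> real) ` set zs)) \<in> measurable N (count_space UNIV)"
  using assms
proof (induction zs)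
  case (Cons b zs)
  have [measurable]: "(\<lambda>\<omega>. h \<omega> b) \<in> borel_measurable N"
      "\<And>a. a \<in> set zs \<Longrightarrow> (\<lambda>\<omega>. h \<omega> a) \<in> borel_measurable N"
      "(\<lambda>\<omega>. card (h \<omega> ` set zs)) \<in> measurable N (count_space UNIV)"
    using Cons by auto
  have "card (h \<omega> ` set (b # zs)) =
      (if \<exists>a\<in>set zs. h \<omega> b = h \<omega> a then card (h \<omega> ` set zs) else Suc (card (h \<omega> ` set zs)))" for \<omega>
    by (auto simp: card_insert_if)
  then show ?case
    by simp
qed simp

lemma measurable_alpha_TCF:
  assumes meas: "\<And>a. a \<in> set A \<Longrightarrow> (\<lambda>\<omega>. h \<omega> a) \<in> borel_measurable N"
  shows "(\<lambda>\<omega>. alpha_TCF k A (h \<omega>)) \<in> borel_measurable N"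
proof -
  let ?f = "\<lambda>p \<omega>. fst (fold (alpha_TCF_step (real k / (real k + 1))) (map (h \<omega>) (drop p A))
    (0, h \<omega> ` set (take p A)))"
  have [measurable]: "(\<lambda>\<omega>. card (h \<omega> ` set (take j A))) \<in> measurable N (count_space UNIV)" for j
    by (rule measurable_card_image) (auto intro: meas dest: in_set_takeD)
  have "(\<lambda>\<omega>. prefix_length k (map (h \<omega>) A)) \<in> measurable N (count_space UNIV)"
    unfolding prefix_length_def take_map set_map by measurable
  moreover have "?f p \<in> measurable N (count_space UNIV)" for p
    by (rule measurable_fold_alpha_TCF_step) (auto intro: meas dest: in_set_takeD in_set_dropD)
  \<comment> \<open>The random prefix length takes countably many values, so it suffices to treat
    each fixed length.\<close>
  ultimately have [measurable]:
    "(\<lambda>\<omega>. ?f (prefix_length k (map (h \<omega>) A)) \<omega>) \<in> measurable N (count_space UNIV)"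
    by (rule measurable_compose_countable[rotated])
  have "alpha_TCF k A (h \<omega>) =
      (real k / (real k + 1)) ^ ?f (prefix_length k (map (h \<omega>) A)) \<omega>" for \<omega>
    by (simp add: alpha_TCF_def Let_def take_map drop_map case_prod_beta)
  then show ?thesis
    by simp
qed

section \<open>Expectation and variance of the sample size\<close>

theorem theorem13:
  fixes n k :: nat and A :: "nat list"
    and M :: "'w measure" and H :: "'w \<Rightarrow> nat \<Rightarrow> real"
  assumes "k > 0"
    and "set A \<subseteq> {1..n}"
    and "card (set A) \<ge> k"
    and "perfectly_random_hash n M H"
  shows "prob_space.expectation M (\<lambda>\<omega>. real (sample_size k A (H \<omega>))) = real k \<and>
         prob_space.variance M (\<lambda>\<omega>. real (sample_size k A (H \<omega>))) < real k / 2 + 1 / 4"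
proof -
  interpret prob_space M
    using assms(4) by (simp add: perfectly_random_hash_def)
  interpret uniform_family M "\<lambda>a \<omega>. H \<omega> a" "{1..n}"
    using assms(4) by unfold_locales (auto simp: perfectly_random_hash_def)
  let ?\<tau> = "tcf_threshold k" and ?xs = "remdups (rev A)"
  let ?S = "\<lambda>\<omega>. real (sample_size k A (H \<omega>))"
  let ?B = "\<lambda>\<omega>. below (?\<tau> (accepted ?\<tau> ?xs (H \<omega>))) ?xs (H \<omega>)"
  have H [measurable]: "(\<lambda>\<omega>. H \<omega> a) \<in> borel_measurable M" if "a \<in> set A" for a
    using measurable_X[of a] that assms(2) by auto
  have sample_size_below: "sample_size k A h = below (alpha_TCF k A h) ?xs h" for h
    by (simp add: sample_size_def below_def)
  have S [measurable]: "?S \<in> borel_measurable M"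
    unfolding sample_size_below
    by (intro measurable_compose[OF measurable_below] measurable_alpha_TCF H) auto
  have B [measurable]: "(\<lambda>\<omega>. real (?B \<omega>)) \<in> borel_measurable M"
    by (intro measurable_compose[OF measurable_below]
        measurable_compose[OF measurable_accepted, where g = ?\<tau>] H) auto
  \<comment> \<open>The algorithm is identified with the sampling process only off the null event of
    hash collisions.\<close>
  have "AE \<omega> in M. inj_on (H \<omega>) (set A)"
    using AE_inj_on[of "set A"] assms(2) by simp
  then have AE_eq: "AE \<omega> in M. ?S \<omega> = ?B \<omega>"
  proof (rule AE_mp, intro AE_I2 impI)
    fix \<omega> assume "\<omega> \<in> space M" "inj_on (H \<omega>) (set A)"
    then show "?S \<omega> = ?B \<omega>"
      using range[of _ \<omega>] assms by (simp add: sample_size_below alpha_TCF_eq_tcf_threshold subset_iff)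
  qed
  obtain V where V: "V \<le> (real k ^ 2 + real k) / (2 * real k + 1)"
    "\<And>c. expectation (\<lambda>\<omega>. (real (?B \<omega>) - c)\<^sup>2) = (real k - c)\<^sup>2 + V"
    using expectation_below_tcf_threshold[of k ?xs] assms by (auto simp: length_remdups_card_conv)
  have square: "expectation (\<lambda>\<omega>. (?S \<omega> - c)\<^sup>2) = (real k - c)\<^sup>2 + V" for c
  proof -
    have "expectation (\<lambda>\<omega>. (?S \<omega> - c)\<^sup>2) = expectation (\<lambda>\<omega>. (real (?B \<omega>) - c)\<^sup>2)"
      using AE_eq by (intro integral_cong_AE) auto
    then show ?thesis
      by (simp add: V(2))
  qed
  have int: "integrable M (\<lambda>\<omega>. (?S \<omega> - c)\<^sup>2)" for c
  proof (rule integrable_const_bound)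
    have "\<bar>?S \<omega> - c\<bar> \<le> real (length ?xs) + \<bar>c\<bar>" for \<omega>
      using below_le_length[of "alpha_TCF k A (H \<omega>)" ?xs "H \<omega>"] unfolding sample_size_below
      by linarith
    then have "(?S \<omega> - c)\<^sup>2 \<le> (real (length ?xs) + \<bar>c\<bar>)\<^sup>2" for \<omega>
      by (metis abs_ge_zero power2_abs power_mono)
    then show "AE \<omega> in M. norm ((?S \<omega> - c)\<^sup>2) \<le> (real (length ?xs) + \<bar>c\<bar>)\<^sup>2"
      by simp
  qed measurable
  \<comment> \<open>The identity x = (x^2 - (x - 1)^2 + 1) / 2 reads the mean off the second moments
    about 0 and 1.\<close>
  have "expectation ?S = expectation (\<lambda>\<omega>. ((?S \<omega> - 0)\<^sup>2 - (?S \<omega> - 1)\<^sup>2 + 1) / 2)"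
    by (intro Bochner_Integration.integral_cong) (simp_all add: power2_eq_square algebra_simps)
  also have "\<dots> = (expectation (\<lambda>\<omega>. (?S \<omega> - 0)\<^sup>2) - expectation (\<lambda>\<omega>. (?S \<omega> - 1)\<^sup>2) + 1) / 2"
    using int[of 0] int[of 1] by (simp add: prob_space)
  also have "\<dots> = real k"
    unfolding square by (simp add: power2_eq_square algebra_simps)
  finally have mean: "expectation ?S = real k" .
  \<comment> \<open>After clearing denominators this is 4 k^2 + 4 k < (2 k + 1)^2, where the sides
    differ by exactly 1.\<close>
  have "(real k ^ 2 + real k) / (2 * real k + 1) < real k / 2 + 1 / 4"
    by (simp add: divide_simps power2_eq_square algebra_simps)
  then have "variance ?S < real k / 2 + 1 / 4"
    using V(1) unfolding mean square by simp
  with mean show ?thesis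
    by simp
qed

end
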